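(* Let $R$ be a 2-Henselian valuation ring with $v(2)>0$. Let $M$ be a unimodular $R$-lattice whose discriminant in a given basis is in $1+I_{0}$, and let $L$ be an $R$-lattice with $v(L)>0$. Write the discriminant of $M$ in this basis as $1+r$, with $r\neq0$, and assume that there exist primitive elements $x\in M$ and $y\in L$, with norms $a$ and $b$ respectively, such that $t^{2}ab\in r+I_{v(r)}$ for some $t\in R$. Then the lattice $M\oplus L$ is isomorphic to $N\oplus K$ (orthogonal direct sums), where $N$ is a lattice having the same reduction modulo $I_{0}$ as $M$ and having (in a suitable basis) discriminant $1+s$ with $v(s)>v(r)$, and $K$ is a lattice with the same valuation as $L$ and whose discriminant (in a suitable basis) is the discriminant of $L$ multiplied by $1+t^{2}ab$.
   Context: A valuation ring $R$ is an integral domain with fraction field $\mathbb{K}$, a totally ordered abelian group $\Gamma$ (additive, arbitrary rank) and a surjective homomorphism $v:\mathbb{K}^{*}\to\Gamma$ with $v(x+y)\geq\min\{v(x),v(y)\}$, extended by $v(0)=\infty$, such that $R=\{x\in\mathbb{K}: v(x)\geq0\}$. For $\gamma\in\Gamma$, $I_{\gamma}=\{x\in\mathbb{K}: v(x)>\gamma\}$; $I_{0}$ is the maximal ideal. $R$ is 2-Henselian if $2\neq0$ in $R$ and for every monic $f\in R[x]$ of degree 2 and every $a\in R$ with $v(f(a))>0$ and $v(f'(a))=0$ there is a root $b\in R$ of $f$ with $b-a\in I_{0}$. An $R$-lattice is a free $R$-module $M$ of finite rank with a symmetric bilinear form $(\cdot,\cdot):M\times M\to R$ which is non-degenerate, i.e.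 the induced map $M\to \mathrm{Hom}_{R}(M,R)$ is injective; it is unimodular if this map is bijective. The norm of $x$ is $(x,x)$. The valuation of a lattice is $v(M)=\min\{v((x,y)): x,y\in M\}$. An element $x\in M$ is primitive if $M/Rx$ is torsion-free. The discriminant of a lattice in a basis is the determinant of the Gram matrix of that basis. The reduction of $M$ modulo $I_{0}$ is $M/I_{0}M$ with the induced $R/I_{0}$-valued bilinear form; "the same reduction" means isomorphic as bilinear spaces over $R/I_{0}$. *)

theory Defs
  imports
    "HOL-Algebra.QuotRing"
    "HOL-Library.Extended"
    "HOL-Library.Set_Algebras"
    "HOL-Computational_Algebra.Polynomial_Factorial"
    "Jordan_Normal_Form.Determinant"
    "Jordan_Normal_Form.VS_Connect"
begin

section \<open>Valuation rings\<close>

text \<open>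
  The valuation ring is the whole type \<open>'r\<close> and its fraction field is \<open>'r fract\<close>. The map \<open>v\<close> is
  meaningful on nonzero elements only; \<open>val v\<close> is its extension by \<open>v(0) = \<infinity>\<close>. The additional
  element \<open>-\<infinity>\<close> of the library type is never a value of \<open>val v\<close>.
\<close>

definition val :: "('r::idom fract \<Rightarrow> 'g) \<Rightarrow> 'r fract \<Rightarrow> 'g extended" where
  "val v x = (if x = 0 then \<infinity> else Fin (v x))"

locale valuation_ring =
  fixes v :: "'r::idom fract \<Rightarrow> 'g::linordered_ab_group_add"
  assumes v_surj: "v ` (- {0}) = UNIV"
    and v_mult: "\<lbrakk>x \<noteq> 0; y \<noteq> 0\<rbrakk> \<Longrightarrow> v (x * y) = v x + v y"
    and v_add: "min (val v x) (val v y) \<le> val v (x + y)"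
    and range_to_fract: "range to_fract = {x. 0 \<le> val v x}"

definition valR :: "('r::idom fract \<Rightarrow> 'g) \<Rightarrow> 'r \<Rightarrow> 'g extended" where
  "valR v x = val v (to_fract x)"

definition val_ideal :: "('r::idom fract \<Rightarrow> 'g::linorder) \<Rightarrow> 'g \<Rightarrow> 'r fract set" where
  "val_ideal v \<gamma> = {x. Fin \<gamma> < val v x}"

text \<open>\<open>I\<^sub>0\<close>, regarded as a subset of the ring.\<close>

definition max_ideal :: "('r::idom fract \<Rightarrow> 'g::linordered_ab_group_add) \<Rightarrow> 'r set" where
  "max_ideal v = to_fract -` val_ideal v 0"

locale two_henselian_valuation_ring = valuation_ring v
  for v :: "'r::idom fract \<Rightarrow> 'g::linordered_ab_group_add" +
  assumes two_nonzero: "(2::'r) \<noteq> 0"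
    and root_lifting:
      "\<lbrakk>lead_coeff f = 1; degree f = 2; 0 < valR v (poly f a); valR v (poly (pderiv f) a) = 0\<rbrakk>
        \<Longrightarrow> \<exists>b. poly f b = 0 \<and> b - a \<in> max_ideal v"


section \<open>Modules with a bilinear form\<close>

record ('r, 'm) bilinear_module = "('r, 'm) module" +
  form :: "'m \<Rightarrow> 'm \<Rightarrow> 'r"

locale symmetric_bilinear_module = Module.module R M
  for R :: "('r, 'a) ring_scheme" and M :: "('r, 'm, 'b) bilinear_module_scheme" +
  assumes form_closed: "\<lbrakk>x \<in> carrier M; y \<in> carrier M\<rbrakk> \<Longrightarrow> form M x y \<in> carrier R"
    and form_sym: "\<lbrakk>x \<in> carrier M; y \<in> carrier M\<rbrakk> \<Longrightarrow> form M x y = form M y x"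
    and form_add: "\<lbrakk>x \<in> carrier M; y \<in> carrier M; z \<in> carrier M\<rbrakk>
      \<Longrightarrow> form M (x \<oplus>\<^bsub>M\<^esub> y) z = form M x z \<oplus>\<^bsub>R\<^esub> form M y z"
    and form_smult: "\<lbrakk>c \<in> carrier R; x \<in> carrier M; y \<in> carrier M\<rbrakk>
      \<Longrightarrow> form M (c \<odot>\<^bsub>M\<^esub> x) y = c \<otimes>\<^bsub>R\<^esub> form M x y"

definition is_basis :: "('r, 'a) ring_scheme \<Rightarrow> ('r, 'm, 'b) module_scheme \<Rightarrow> 'm list \<Rightarrow> bool" where
  "is_basis R M bs \<longleftrightarrow> distinct bs \<and> set bs \<subseteq> carrier M \<and>
    \<not> LinearCombinations.module.lin_dep R M (set bs) \<and>
    LinearCombinations.module.span R M (set bs) = carrier M"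

definition ring_as_module :: "('r, 'a) ring_scheme \<Rightarrow> ('r, 'r) module" where
  "ring_as_module R = \<lparr>carrier = carrier R, mult = mult R, one = one R, zero = zero R,
    add = add R, smult = mult R\<rparr>"

text \<open>
  The linear forms are taken to be extensional, so that functions which agree on the carrier are equal.
\<close>

definition dual_module :: "('r, 'a) ring_scheme \<Rightarrow> ('r, 'm, 'b) module_scheme \<Rightarrow> ('m \<Rightarrow> 'r) set" where
  "dual_module R M = LinearCombinations.module_hom R M (ring_as_module R) \<inter> extensional (carrier M)"

definition form_map :: "('r, 'm, 'b) bilinear_module_scheme \<Rightarrow> 'm \<Rightarrow> 'm \<Rightarrow> 'r" where
  "form_map M x = restrict (form M x) (carrier M)"

locale lattice_over = symmetric_bilinear_module R M
  for R :: "('r, 'a) ring_scheme" and M :: "('r, 'm, 'b) bilinear_module_scheme" +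
  assumes free_of_finite_rank: "\<exists>bs. is_basis R M bs"
    and nondegenerate: "inj_on (form_map M) (carrier M)"

definition unimodular :: "('r, 'a) ring_scheme \<Rightarrow> ('r, 'm, 'b) bilinear_module_scheme \<Rightarrow> bool" where
  "unimodular R M \<longleftrightarrow> bij_betw (form_map M) (carrier M) (dual_module R M)"

text \<open>The fields \<open>mult\<close> and \<open>one\<close> of a module record carry no meaning and are filled arbitrarily.\<close>

definition quotient_module :: "('r, 'm, 'b) module_scheme \<Rightarrow> 'm set \<Rightarrow> ('r, 'm set) module" where
  "quotient_module M H = \<lparr>carrier = a_rcosets\<^bsub>M\<^esub> H, mult = (\<lambda>_ _. H), one = H, zero = H,
    add = set_add M, smult = (\<lambda>c X. \<Union>x\<in>X. H +>\<^bsub>M\<^esub> (c \<odot>\<^bsub>M\<^esub> x))\<rparr>"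

definition torsion_free :: "('r, 'a) ring_scheme \<Rightarrow> ('r, 'm, 'b) module_scheme \<Rightarrow> bool" where
  "torsion_free R M \<longleftrightarrow>
    (\<forall>c\<in>carrier R. \<forall>x\<in>carrier M. c \<odot>\<^bsub>M\<^esub> x = \<zero>\<^bsub>M\<^esub> \<longrightarrow> c = \<zero>\<^bsub>R\<^esub> \<or> x = \<zero>\<^bsub>M\<^esub>)"

definition primitive :: "('r, 'a) ring_scheme \<Rightarrow> ('r, 'm, 'b) module_scheme \<Rightarrow> 'm \<Rightarrow> bool" where
  "primitive R M x \<longleftrightarrow> x \<in> carrier M \<and>
    torsion_free R (quotient_module M ((\<lambda>c. c \<odot>\<^bsub>M\<^esub> x) ` carrier R))"

definition isometric :: "('r, 'a) ring_scheme \<Rightarrow> ('r, 'm, 'b) bilinear_module_scheme \<Rightarrow>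
    ('r, 'n, 'c) bilinear_module_scheme \<Rightarrow> bool" where
  "isometric R M N \<longleftrightarrow> (\<exists>f\<in>LinearCombinations.module_hom R M N. bij_betw f (carrier M) (carrier N) \<and>
    (\<forall>x\<in>carrier M. \<forall>y\<in>carrier M. form N (f x) (f y) = form M x y))"

definition orthogonal_sum :: "('r::plus, 'm, 'b) bilinear_module_scheme \<Rightarrow>
    ('r, 'n, 'c) bilinear_module_scheme \<Rightarrow> ('r, 'm \<times> 'n) bilinear_module" where
  "orthogonal_sum M L = module.extend (direct_sum M L)
    (bilinear_module.fields (\<lambda>(x, y) (x', y'). form M x x' + form L y y'))"

definition ideal_times_module ::
    "('r, 'a) ring_scheme \<Rightarrow> 'r set \<Rightarrow> ('r, 'm, 'b) module_scheme \<Rightarrow> 'm set" where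
  "ideal_times_module R I M = LinearCombinations.module.span R M {c \<odot>\<^bsub>M\<^esub> x | c x. c \<in> I \<and> x \<in> carrier M}"

text \<open>
  \<open>M/IM\<close> with the induced form, to be read over the ring \<open>R Quot I\<close>. Scalar multiplication and form
  are defined on cosets in the style of \<^const>\<open>rcoset_mult\<close>: the unions below are taken over
  representatives and consist of copies of a single coset.
\<close>

definition reduction :: "('r, 'a) ring_scheme \<Rightarrow> 'r set \<Rightarrow> ('r, 'm, 'b) bilinear_module_scheme
    \<Rightarrow> ('r set, 'm set) bilinear_module" where
  "reduction R I M = (let IM = ideal_times_module R I M in
    \<lparr>carrier = a_rcosets\<^bsub>M\<^esub> IM, mult = (\<lambda>_ _. IM), one = IM, zero = IM, add = set_add M,
     smult = (\<lambda>C X. \<Union>c\<in>C. \<Union>x\<in>X. IM +>\<^bsub>M\<^esub> (c \<odot>\<^bsub>M\<^esub> x)),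
     form = (\<lambda>X Y. \<Union>x\<in>X. \<Union>y\<in>Y. I +>\<^bsub>R\<^esub> form M x y)\<rparr>)"

definition discriminant :: "('r::comm_ring_1, 'm, 'b) bilinear_module_scheme \<Rightarrow> 'm list \<Rightarrow> 'r" where
  "discriminant M bs = det (mat (length bs) (length bs) (\<lambda>(i, j). form M (bs ! i) (bs ! j)))"

text \<open>
  For a lattice the minimum exists: it is attained on a pair of basis vectors, and is \<open>\<infinity>\<close> in rank zero.
\<close>

definition lattice_val :: "('r::idom fract \<Rightarrow> 'g::linorder) \<Rightarrow> ('r, 'm, 'b) bilinear_module_scheme
    \<Rightarrow> 'g extended" where
  "lattice_val v M =
    (LEAST \<gamma>. \<gamma> \<in> (\<lambda>(x, y). valR v (form M x y)) ` (carrier M \<times> carrier M))"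

end

theory Submission
  imports Defs
begin

text \<open>
  Put \<open>c = t\<^sup>2 a b\<close>. Tilt \<open>M\<close> and \<open>L\<close> against each other inside \<open>M \<oplus> L\<close>: the vectors
  \<open>w + t (w, x) y\<close> with \<open>w \<in> M\<close> form a submodule \<open>N\<close>, and those \<open>l - t (l, y) x\<close> with \<open>l \<in> L\<close> form a
  submodule \<open>K\<close>. The signs make \<open>N\<close> and \<open>K\<close> orthogonal, and the map \<open>N \<oplus> K \<rightarrow> M \<oplus> L\<close> is invertible
  exactly when \<open>1 + c\<close> is a unit, which holds since \<open>v(b) \<ge> v(L) > 0\<close>.

  Parametrised by \<open>M\<close> itself, \<open>N\<close> is the module \<open>M\<close> with the form
  \<open>(w, w') + t\<^sup>2 b (w, x) (w', x)\<close>, and likewise \<open>K\<close> is \<open>L\<close> with the form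
  \<open>(l, l') + t\<^sup>2 a (l, y) (l', y)\<close>. Everything else is a statement about such a rank-one change
  of a form (\<open>rank_one_twist\<close>). Bases do not change, and the matrix determinant lemma
  multiplies both discriminants by \<open>1 + c\<close> (\<open>discriminant_rank_one_twist\<close>). The change to \<open>M\<close> is
  divisible by \<open>b \<in> I\<^sub>0\<close>, hence invisible modulo \<open>I\<^sub>0\<close> (\<open>reduction_rank_one_twist\<close>); the change to \<open>L\<close> is a
  multiple of a product of two values of the form of \<open>L\<close>, hence of larger valuation than \<open>v(L)\<close> if \<open>v(L) < \<infinity>\<close>
  (\<open>lattice_val_rank_one_twist\<close>).

  The discriminant of \<open>N\<close> is \<open>(1 + r) (1 + c) = 1 + (2 r + (c - r) + r c)\<close>. All three
  summands have valuation above \<open>v(r)\<close>: the first since \<open>v(2) > 0\<close>, the second by the choice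
  of \<open>t\<close>, the third since \<open>v(c) > 0\<close>. It is \<open>v(2) > 0\<close> that allows multiplication by \<open>1 + c\<close> to
  cancel the leading term of \<open>r\<close>.
\<close>

section \<open>Rank-one twists of a symmetric bilinear form\<close>

text \<open>
  The form pulled back along \<open>w \<mapsto> w + t (w, x) y\<close> from the sum of \<open>M\<close> with a module that contains
  \<open>y\<close>, where \<open>c = t\<^sup>2 (y, y)\<close>.
\<close>

definition rank_one_twist :: "'r::comm_ring_1 \<Rightarrow> 'm \<Rightarrow> ('r, 'm) bilinear_module \<Rightarrow> ('r, 'm) bilinear_module" where
  "rank_one_twist c x M = M\<lparr>form := (\<lambda>w w'. form M w w' + c * form M w x * form M w' x)\<rparr>"

lemma rank_one_twist_simps [simp]:
  "carrier (rank_one_twist c x M) = carrier M" "add (rank_one_twist c x M) = add M" "zero (rank_one_twist c x M) = zero M"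
  "smult (rank_one_twist c x M) = smult M"
  "form (rank_one_twist c x M) w w' = form M w w' + c * form M w x * form M w' x"
  by (simp_all add: rank_one_twist_def)

lemma module_rank_one_twist:
  assumes "module class_ring M" shows "module class_ring (rank_one_twist c x M)"
  using assms
  by (simp add: Module.module_def abelian_group_def abelian_monoid_def abelian_group_axioms_def module_axioms_def)

lemma lincomb_rank_one_twist:
  assumes "module class_ring M"
  shows "LinearCombinations.module.lincomb (rank_one_twist c x M) = LinearCombinations.module.lincomb M"
  by (intro ext) (simp add: LinearCombinations.module.lincomb_def[OF assms]
    LinearCombinations.module.lincomb_def[OF module_rank_one_twist[OF assms]] finsum_def)

lemma span_rank_one_twist:
  assumes "module class_ring M"
  shows "LinearCombinations.module.span class_ring (rank_one_twist c x M) = LinearCombinations.module.span class_ring M"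
  using assms module_rank_one_twist[OF assms]
  by (intro ext) (simp add: LinearCombinations.module.span_def lincomb_rank_one_twist[OF assms])

lemma is_basis_rank_one_twist:
  assumes "module class_ring M"
  shows "is_basis class_ring (rank_one_twist c x M) bs \<longleftrightarrow> is_basis class_ring M bs"
  using assms module_rank_one_twist[OF assms]
  by (simp add: is_basis_def span_rank_one_twist LinearCombinations.module.lin_dep_def lincomb_rank_one_twist[OF assms])

section \<open>The discriminant of a twist\<close>

text \<open>
  The matrix determinant lemma. The block matrix with rows \<open>(1, -w)\<close> and \<open>(u, I)\<close> has a factorisation
  into block triangular matrices in either order; one of them exhibits its Schur complement \<open>1 + w u\<close>,
  the other one \<open>I + u w\<close>.
\<close>

lemma det_one_plus_rank_one:
  fixes u w :: "nat \<Rightarrow> 'r::idom"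
  shows "det (mat n n (\<lambda>(i, j). (if i = j then 1 else 0) + u i * w j)) = 1 + (\<Sum>i<n. w i * u i)"
proof -
  let ?W = "mat 1 n (\<lambda>(i, j). - w j)" and ?U = "mat n 1 (\<lambda>(i, j). u i)"
  let ?s = "mat 1 1 (\<lambda>_. 1 + (\<Sum>i<n. w i * u i))"
  let ?P = "mat n n (\<lambda>(i, j). (if i = j then 1 else 0) + u i * w j)"
  let ?L = "four_block_mat (1\<^sub>m 1) (0\<^sub>m 1 n) ?U (1\<^sub>m n)"
  have "four_block_mat ?s ?W (0\<^sub>m n 1) (1\<^sub>m n) * ?L
      = four_block_mat (?s * 1\<^sub>m 1 + ?W * ?U) (?s * 0\<^sub>m 1 n + ?W * 1\<^sub>m n)
          (0\<^sub>m n 1 * 1\<^sub>m 1 + 1\<^sub>m n * ?U) (0\<^sub>m n 1 * 0\<^sub>m 1 n + 1\<^sub>m n * 1\<^sub>m n)"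
    by (rule mult_four_block_mat) auto
  also have "?s * 1\<^sub>m 1 + ?W * ?U = 1\<^sub>m 1"
    by (intro eq_matI) (auto simp: scalar_prod_def sum_negf atLeast0LessThan)
  also have "?s * 0\<^sub>m 1 n + ?W * 1\<^sub>m n = ?W" by (intro eq_matI) auto
  also have "0\<^sub>m n 1 * 1\<^sub>m 1 + 1\<^sub>m n * ?U = ?U" by (intro eq_matI) auto
  also have "0\<^sub>m n 1 * 0\<^sub>m 1 n + 1\<^sub>m n * 1\<^sub>m n = (1\<^sub>m n :: 'r mat)"
    by (simp add: right_mult_one_mat[of _ n n])
  finally have 1: "four_block_mat ?s ?W (0\<^sub>m n 1) (1\<^sub>m n) * ?L = four_block_mat (1\<^sub>m 1) ?W ?U (1\<^sub>m n)" .
  have "?L * four_block_mat (1\<^sub>m 1) ?W (0\<^sub>m n 1) ?P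
      = four_block_mat (1\<^sub>m 1 * 1\<^sub>m 1 + 0\<^sub>m 1 n * 0\<^sub>m n 1) (1\<^sub>m 1 * ?W + 0\<^sub>m 1 n * ?P)
          (?U * 1\<^sub>m 1 + 1\<^sub>m n * 0\<^sub>m n 1) (?U * ?W + 1\<^sub>m n * ?P)"
    by (rule mult_four_block_mat) auto
  also have "1\<^sub>m 1 * 1\<^sub>m 1 + 0\<^sub>m 1 n * 0\<^sub>m n 1 = (1\<^sub>m 1 :: 'r mat)" by (intro eq_matI) auto
  also have "1\<^sub>m 1 * ?W + 0\<^sub>m 1 n * ?P = ?W" by (intro eq_matI) auto
  also have "?U * 1\<^sub>m 1 + 1\<^sub>m n * 0\<^sub>m n 1 = ?U" by (intro eq_matI) auto
  also have "?U * ?W + 1\<^sub>m n * ?P = 1\<^sub>m n"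
    by (intro eq_matI) (auto simp: scalar_prod_def)
  finally have 2: "?L * four_block_mat (1\<^sub>m 1) ?W (0\<^sub>m n 1) ?P = four_block_mat (1\<^sub>m 1) ?W ?U (1\<^sub>m n)" .
  have dL: "det ?L = 1" by (subst det_four_block_mat_upper_right_zero[of _ 1 _ n]) auto
  have dS: "det (four_block_mat ?s ?W (0\<^sub>m n 1) (1\<^sub>m n)) = 1 + (\<Sum>i<n. w i * u i)"
    by (subst det_four_block_mat_lower_left_zero[of _ 1 _ n]) (auto simp: det_single)
  have dP: "det (four_block_mat (1\<^sub>m 1) ?W (0\<^sub>m n 1) ?P) = det ?P"
    by (subst det_four_block_mat_lower_left_zero[of _ 1 _ n]) auto
  have "det (four_block_mat ?s ?W (0\<^sub>m n 1) (1\<^sub>m n)) * det ?L = det ?L * det (four_block_mat (1\<^sub>m 1) ?W (0\<^sub>m n 1) ?P)"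
    by (subst (1 2) det_mult[of _ "1 + n", symmetric]) (use 1 2 in auto)
  then show ?thesis by (simp only: dL dS dP mult_1_right mult_1_left)
qed

lemma form_lincomb:
  fixes M :: "('r::comm_ring_1, 'm) bilinear_module"
  assumes "symmetric_bilinear_module class_ring M" "finite A" "A \<subseteq> carrier M" "z \<in> carrier M"
  shows "form M (LinearCombinations.module.lincomb M a A) z = (\<Sum>w\<in>A. a w * form M w z)"
proof -
  interpret symmetric_bilinear_module class_ring M by fact
  have zero: "form M \<zero>\<^bsub>M\<^esub> z = 0"
    using form_smult[of 0 z z] assms(4) smult_l_null[of z] by simp
  show ?thesis using assms(2,3)
  proof (induction A)
    case empty
    then show ?case by (simp add: lincomb_def zero)
  next
    case (insert w A)
    then show ?case using assms(4) lincomb_insert[of A a w]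
      by (simp add: form_add form_smult)
  qed
qed

lemma coordinates:
  fixes M :: "('r::comm_ring_1, 'm) bilinear_module"
  assumes M: "symmetric_bilinear_module class_ring M" and "is_basis class_ring M bs" "x \<in> carrier M"
  obtains \<xi> where "\<And>z. z \<in> carrier M \<Longrightarrow> form M x z = (\<Sum>w\<in>set bs. \<xi> w * form M w z)"
proof -
  interpret symmetric_bilinear_module class_ring M by fact
  have "x \<in> span (set bs)" "set bs \<subseteq> carrier M"
    using assms by (auto simp: is_basis_def)
  then obtain a where "x = lincomb a (set bs)"
    using finite_in_span[of "set bs" x] by auto
  then show ?thesis using form_lincomb[OF M _ \<open>set bs \<subseteq> carrier M\<close>] that by auto
qed

text \<open>
  Let \<open>G\<close> be the Gram matrix and \<open>\<xi>\<close> the coordinates of \<open>x\<close>. The values of the form at \<open>x\<close> and the basis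
  are the entries of \<open>G \<xi>\<close>, so the Gram matrix of the twist is \<open>G + c (G \<xi>) (G \<xi>)\<^sup>T = G (I + c \<xi> (G \<xi>)\<^sup>T)\<close>.
  The second factor has determinant \<open>1 + c \<xi>\<^sup>T G \<xi>\<close>.
\<close>

lemma discriminant_rank_one_twist:
  fixes M :: "('r::idom, 'm) bilinear_module"
  assumes M: "symmetric_bilinear_module class_ring M" and B: "is_basis class_ring M bs" and x: "x \<in> carrier M"
  shows "discriminant (rank_one_twist c x M) bs = discriminant M bs * (1 + c * form M x x)"
proof -
  interpret symmetric_bilinear_module class_ring M by fact
  obtain \<xi> where \<xi>: "\<And>z. z \<in> carrier M \<Longrightarrow> form M x z = (\<Sum>w\<in>set bs. \<xi> w * form M w z)"
    using coordinates[OF M B x] by blast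
  define n where "n = length bs"
  have in_carrier: "bs ! i \<in> carrier M" if "i < n" for i
    using B that by (auto simp: is_basis_def n_def)
  have sum_bs: "(\<Sum>w\<in>set bs. h w) = (\<Sum>i<n. h (bs ! i))" for h :: "'m \<Rightarrow> 'r"
    using B sum.reindex_bij_betw[OF bij_betw_nth[of bs "{..<n}" "set bs"], of h]
    by (auto simp: is_basis_def n_def)
  have sym: "form M w z = form M z w" if "w \<in> carrier M" "z \<in> carrier M" for w z
    using form_sym that by simp
  let ?G = "mat n n (\<lambda>(i, j). form M (bs ! i) (bs ! j))"
  let ?P = "mat n n (\<lambda>(i, j). (if i = j then 1 else 0) + (c * \<xi> (bs ! i)) * form M (bs ! j) x)"
  have "mat n n (\<lambda>(i, j). form (rank_one_twist c x M) (bs ! i) (bs ! j)) = ?G * ?P"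
  proof (intro eq_matI; clarsimp simp: scalar_prod_def)
    fix i j assume ij: "i < n" "j < n"
    have "form M (bs ! i) x = (\<Sum>k<n. \<xi> (bs ! k) * form M (bs ! i) (bs ! k))"
      using sym[OF x in_carrier[OF ij(1)]] \<xi>[OF in_carrier[OF ij(1)]] sum_bs[of "\<lambda>w. \<xi> w * form M w (bs ! i)"]
        sym[OF in_carrier[OF ij(1)] in_carrier] by simp
    then show "form M (bs ! i) (bs ! j) + c * form M (bs ! i) x * form M (bs ! j) x =
       (\<Sum>k = 0..<n. form M (bs ! i) (bs ! k) * ((if k = j then 1 else 0) + c * \<xi> (bs ! k) * form M (bs ! j) x))"
      using ij by (simp add: distrib_left sum.distrib sum_distrib_left sum_distrib_right atLeast0LessThan
        if_distrib[of "\<lambda>z. z * _"] mult_ac cong: if_cong)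
  qed
  then have "discriminant (rank_one_twist c x M) bs = det ?G * det ?P"
    unfolding discriminant_def n_def[symmetric] by (simp add: det_mult[of _ n])
  also have "det ?P = 1 + (\<Sum>i<n. form M (bs ! i) x * (c * \<xi> (bs ! i)))"
    by (rule det_one_plus_rank_one)
  also have "\<dots> = 1 + c * form M x x"
    using \<xi>[OF x] by (simp add: sum_bs sum_distrib_left mult_ac)
  finally show ?thesis by (simp add: discriminant_def n_def)
qed


section \<open>Twisting the two summands of an orthogonal sum\<close>

lemma (in Module.module) shear_add:
  assumes "u \<in> carrier M" "w \<in> carrier M" "x \<in> carrier M" "\<alpha> \<in> carrier R" "\<beta> \<in> carrier R"
  shows "(u \<oplus>\<^bsub>M\<^esub> w) \<oplus>\<^bsub>M\<^esub> (\<alpha> \<oplus>\<^bsub>R\<^esub> \<beta>) \<odot>\<^bsub>M\<^esub> x = (u \<oplus>\<^bsub>M\<^esub> \<alpha> \<odot>\<^bsub>M\<^esub> x) \<oplus>\<^bsub>M\<^esub> (w \<oplus>\<^bsub>M\<^esub> \<beta> \<odot>\<^bsub>M\<^esub> x)"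
  using assms by (simp add: smult_l_distr M.add.m_ac)

lemma (in Module.module) shear_smult:
  assumes "u \<in> carrier M" "x \<in> carrier M" "\<alpha> \<in> carrier R" "k \<in> carrier R"
  shows "k \<odot>\<^bsub>M\<^esub> u \<oplus>\<^bsub>M\<^esub> (k \<otimes>\<^bsub>R\<^esub> \<alpha>) \<odot>\<^bsub>M\<^esub> x = k \<odot>\<^bsub>M\<^esub> (u \<oplus>\<^bsub>M\<^esub> \<alpha> \<odot>\<^bsub>M\<^esub> x)"
  using assms by (simp add: smult_r_distr smult_assoc1)

lemma (in Module.module) shear_shear:
  assumes "u \<in> carrier M" "x \<in> carrier M" "\<alpha> \<in> carrier R" "\<beta> \<in> carrier R" "\<alpha> \<oplus>\<^bsub>R\<^esub> \<beta> = \<zero>\<^bsub>R\<^esub>"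
  shows "(u \<oplus>\<^bsub>M\<^esub> \<alpha> \<odot>\<^bsub>M\<^esub> x) \<oplus>\<^bsub>M\<^esub> \<beta> \<odot>\<^bsub>M\<^esub> x = u"
  using assms smult_l_distr[of \<alpha> \<beta> x] by (simp add: M.add.m_assoc)

lemma form_shear:
  fixes M :: "('r::comm_ring_1, 'm) bilinear_module"
  assumes "symmetric_bilinear_module class_ring M"
    and "u \<in> carrier M" "w \<in> carrier M" "x \<in> carrier M"
  shows "form M (u \<oplus>\<^bsub>M\<^esub> \<alpha> \<odot>\<^bsub>M\<^esub> x) w = form M u w + \<alpha> * form M x w"
proof -
  interpret symmetric_bilinear_module class_ring M by fact
  show ?thesis using assms(2-) smult_closed[of \<alpha> x] by (simp add: form_add form_smult)
qed

text \<open>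
  The map \<open>f (w, l) = (w - t (l, y) x, l + t (w, x) y)\<close> pulls the form of \<open>M \<oplus> L\<close> back to the sum of the
  twisted forms, since the cross terms cancel. To invert \<open>f\<close> at \<open>(u, w)\<close> it suffices to know the products of
  the preimage with \<open>x\<close> and \<open>y\<close>; these solve a linear system of size two with determinant \<open>1 + t\<^sup>2 a b\<close>.
\<close>

lemma isometric_orthogonal_sum_rank_one_twist:
  fixes M :: "('r::comm_ring_1, 'm) bilinear_module" and L :: "('r, 'l) bilinear_module"
  assumes M: "symmetric_bilinear_module class_ring M" and L: "symmetric_bilinear_module class_ring L"
    and x: "x \<in> carrier M" and y: "y \<in> carrier L"
    and e: "e * (1 + t\<^sup>2 * form M x x * form L y y) = 1"
  shows "isometric class_ring (orthogonal_sum M L)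
    (orthogonal_sum (rank_one_twist (t\<^sup>2 * form L y y) x M) (rank_one_twist (t\<^sup>2 * form M x x) y L))"
proof -
  interpret M: symmetric_bilinear_module class_ring M by fact
  interpret L: symmetric_bilinear_module class_ring L by fact
  let ?a = "form M x x" and ?b = "form L y y"
  let ?S = "orthogonal_sum M L"
  let ?T = "orthogonal_sum (rank_one_twist (t\<^sup>2 * ?b) x M) (rank_one_twist (t\<^sup>2 * ?a) y L)"
  \<comment> \<open>Cramer's rule for the products with \<open>x\<close> and \<open>y\<close> of the preimage of \<open>(u, w)\<close> under \<open>f\<close>.\<close>
  define p where "p u w = e * (form M u x + t * ?a * form L w y)" for u w
  define q where "q u w = e * (form L w y - t * ?b * form M u x)" for u w
  define f where "f = (\<lambda>(u, w). (u \<oplus>\<^bsub>M\<^esub> (- (t * form L w y)) \<odot>\<^bsub>M\<^esub> x, w \<oplus>\<^bsub>L\<^esub> (t * form M u x) \<odot>\<^bsub>L\<^esub> y))"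
  define g where "g = (\<lambda>(u, w). (u \<oplus>\<^bsub>M\<^esub> (t * q u w) \<odot>\<^bsub>M\<^esub> x, w \<oplus>\<^bsub>L\<^esub> (- (t * p u w)) \<odot>\<^bsub>L\<^esub> y))"
  have S: "carrier ?S = carrier M \<times> carrier L" "carrier ?T = carrier M \<times> carrier L"
    "add ?S = (\<lambda>z z'. (fst z \<oplus>\<^bsub>M\<^esub> fst z', snd z \<oplus>\<^bsub>L\<^esub> snd z'))" "add ?T = add ?S"
    "smult ?S = (\<lambda>k z. (k \<odot>\<^bsub>M\<^esub> fst z, k \<odot>\<^bsub>L\<^esub> snd z))" "smult ?T = smult ?S"
    "form ?S = (\<lambda>(u, w) (u', w'). form M u u' + form L w w')"
    by (simp_all add: orthogonal_sum_def direct_sum_def module.extend_def bilinear_module.fields_def)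
  have T: "form ?T (u, w) (u', w') = form M u u' + t\<^sup>2 * ?b * form M u x * form M u' x
      + (form L w w' + t\<^sup>2 * ?a * form L w y * form L w' y)" for u w u' w'
    by (simp add: orthogonal_sum_def direct_sum_def module.extend_def bilinear_module.fields_def)
  have [simp, intro]: "\<alpha> \<odot>\<^bsub>M\<^esub> u \<in> carrier M" if "u \<in> carrier M" for \<alpha> u using that M.smult_closed by simp
  have [simp, intro]: "\<alpha> \<odot>\<^bsub>L\<^esub> u \<in> carrier L" if "u \<in> carrier L" for \<alpha> u using that L.smult_closed by simp
  note fM = form_shear[OF M] and fL = form_shear[OF L]
  have p_eq: "form M u x + t * q u w * ?a = p u w" for u w
  proof -
    have "form M u x + t * q u w * ?a = (e * (1 + t\<^sup>2 * ?a * ?b)) * form M u x + t * q u w * ?a"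
      using e by simp
    also have "\<dots> = p u w" by (simp add: p_def q_def algebra_simps power2_eq_square)
    finally show ?thesis .
  qed
  have q_eq: "form L w y - t * p u w * ?b = q u w" for u w
  proof -
    have "form L w y - t * p u w * ?b = (e * (1 + t\<^sup>2 * ?a * ?b)) * form L w y - t * p u w * ?b"
      using e by simp
    also have "\<dots> = q u w" by (simp add: p_def q_def algebra_simps power2_eq_square)
    finally show ?thesis .
  qed
  have p_f: "p (u \<oplus>\<^bsub>M\<^esub> (- (t * form L w y)) \<odot>\<^bsub>M\<^esub> x) (w \<oplus>\<^bsub>L\<^esub> (t * form M u x) \<odot>\<^bsub>L\<^esub> y) = form M u x"
    and q_f: "q (u \<oplus>\<^bsub>M\<^esub> (- (t * form L w y)) \<odot>\<^bsub>M\<^esub> x) (w \<oplus>\<^bsub>L\<^esub> (t * form M u x) \<odot>\<^bsub>L\<^esub> y) = form L w y"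
    if "u \<in> carrier M" "w \<in> carrier L" for u w
  proof -
    have "p (u \<oplus>\<^bsub>M\<^esub> (- (t * form L w y)) \<odot>\<^bsub>M\<^esub> x) (w \<oplus>\<^bsub>L\<^esub> (t * form M u x) \<odot>\<^bsub>L\<^esub> y)
        = (e * (1 + t\<^sup>2 * ?a * ?b)) * form M u x"
      using that x y by (simp add: p_def fM fL algebra_simps power2_eq_square)
    then show "p (u \<oplus>\<^bsub>M\<^esub> (- (t * form L w y)) \<odot>\<^bsub>M\<^esub> x) (w \<oplus>\<^bsub>L\<^esub> (t * form M u x) \<odot>\<^bsub>L\<^esub> y) = form M u x"
      using e by simp
    have "q (u \<oplus>\<^bsub>M\<^esub> (- (t * form L w y)) \<odot>\<^bsub>M\<^esub> x) (w \<oplus>\<^bsub>L\<^esub> (t * form M u x) \<odot>\<^bsub>L\<^esub> y)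
        = (e * (1 + t\<^sup>2 * ?a * ?b)) * form L w y"
      using that x y by (simp add: q_def fM fL algebra_simps power2_eq_square)
    then show "q (u \<oplus>\<^bsub>M\<^esub> (- (t * form L w y)) \<odot>\<^bsub>M\<^esub> x) (w \<oplus>\<^bsub>L\<^esub> (t * form M u x) \<odot>\<^bsub>L\<^esub> y) = form L w y"
      using e by simp
  qed
  have closed: "f z \<in> carrier M \<times> carrier L" "g z \<in> carrier M \<times> carrier L" if "z \<in> carrier M \<times> carrier L" for z
    using that x y by (auto simp: f_def g_def)
  have fg: "f (g z) = z" if "z \<in> carrier M \<times> carrier L" for z
    using that x y p_eq q_eq
    by (auto simp: f_def g_def fM fL intro!: M.shear_shear L.shear_shear)
  have gf: "g (f z) = z" if "z \<in> carrier M \<times> carrier L" for z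
    using that x y p_f q_f
    by (auto simp: f_def g_def intro!: M.shear_shear L.shear_shear)
  have form_f: "form ?S (f z) (f z') = form ?T z z'"
    if "z \<in> carrier M \<times> carrier L" "z' \<in> carrier M \<times> carrier L" for z z'
  proof -
    obtain u w u' w' where z: "z = (u, w)" "z' = (u', w')" by fastforce
    then have c: "u \<in> carrier M" "u' \<in> carrier M" "w \<in> carrier L" "w' \<in> carrier L" using that by auto
    have "form M u (u' \<oplus>\<^bsub>M\<^esub> \<alpha> \<odot>\<^bsub>M\<^esub> x) = form M u u' + \<alpha> * form M u x" if "u \<in> carrier M" for \<alpha> u
      using c x that fM[of u' u x \<alpha>] M.form_sym[of u "u' \<oplus>\<^bsub>M\<^esub> \<alpha> \<odot>\<^bsub>M\<^esub> x"] M.form_sym[of u u'] M.form_sym[of u x]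
      by simp
    moreover have "form L w (w' \<oplus>\<^bsub>L\<^esub> \<alpha> \<odot>\<^bsub>L\<^esub> y) = form L w w' + \<alpha> * form L w y" if "w \<in> carrier L" for \<alpha> w
      using c y that fL[of w' w y \<alpha>] L.form_sym[of w "w' \<oplus>\<^bsub>L\<^esub> \<alpha> \<odot>\<^bsub>L\<^esub> y"] L.form_sym[of w w'] L.form_sym[of w y]
      by simp
    moreover have "form M x u' = form M u' x" "form L y w' = form L w' y"
      using c x y M.form_sym L.form_sym by auto
    ultimately show ?thesis
      using c x y unfolding z S T f_def
      by (simp add: fM fL algebra_simps power2_eq_square)
  qed
  have "bij_betw g (carrier ?S) (carrier ?T)"
    unfolding S by (rule bij_betw_byWitness[where f' = f]) (use closed fg gf in blast)+
  moreover have "form ?T (g z) (g z') = form ?S z z'"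
    if "z \<in> carrier ?S" "z' \<in> carrier ?S" for z z'
    using form_f[of "g z" "g z'"] closed fg that unfolding S(1) by simp
  moreover have "g \<in> LinearCombinations.module_hom class_ring ?S ?T"
  proof -
    have "p (u \<oplus>\<^bsub>M\<^esub> u') (w \<oplus>\<^bsub>L\<^esub> w') = p u w + p u' w'" "q (u \<oplus>\<^bsub>M\<^esub> u') (w \<oplus>\<^bsub>L\<^esub> w') = q u w + q u' w'"
      "p (k \<odot>\<^bsub>M\<^esub> u) (k \<odot>\<^bsub>L\<^esub> w) = k * p u w" "q (k \<odot>\<^bsub>M\<^esub> u) (k \<odot>\<^bsub>L\<^esub> w) = k * q u w"
      if "u \<in> carrier M" "u' \<in> carrier M" "w \<in> carrier L" "w' \<in> carrier L" for u u' w w' k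
      using that x y M.form_add L.form_add M.form_smult L.form_smult
      by (simp_all add: p_def q_def algebra_simps)
    note pq = this
    have "g (u \<oplus>\<^bsub>M\<^esub> u', w \<oplus>\<^bsub>L\<^esub> w') = (fst (g (u, w)) \<oplus>\<^bsub>M\<^esub> fst (g (u', w')), snd (g (u, w)) \<oplus>\<^bsub>L\<^esub> snd (g (u', w')))"
      if "u \<in> carrier M" "u' \<in> carrier M" "w \<in> carrier L" "w' \<in> carrier L" for u u' w w'
      using that x y M.shear_add[of u u' x "t * q u w" "t * q u' w'"]
        L.shear_add[of w w' y "- (t * p u w)" "- (t * p u' w')"]
      by (simp add: g_def pq distrib_left)
    moreover have "g (k \<odot>\<^bsub>M\<^esub> u, k \<odot>\<^bsub>L\<^esub> w) = (k \<odot>\<^bsub>M\<^esub> fst (g (u, w)), k \<odot>\<^bsub>L\<^esub> snd (g (u, w)))"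
      if "u \<in> carrier M" "w \<in> carrier L" for k u w
      using that x y M.shear_smult[of u x "t * q u w" k] L.shear_smult[of w y "- (t * p u w)" k]
      by (simp add: g_def pq mult_ac)
    ultimately show ?thesis
      unfolding LinearCombinations.module_hom_def S using closed by auto
  qed
  ultimately show ?thesis unfolding isometric_def by blast
qed

section \<open>Valuations, reduction and nondegeneracy\<close>

context valuation_ring
begin

lemma val_mult: "val v (x * y) = val v x + val v y"
  by (simp add: val_def v_mult)

lemma val_one: "val v 1 = 0"
  using v_mult[of 1 1] by (simp add: val_def zero_extended_def)

lemma valR_nonneg: "0 \<le> valR v c"
  using range_to_fract by (auto simp: valR_def)

lemma valR_mult: "valR v (c * d) = valR v c + valR v d"
  by (simp add: valR_def val_mult)

lemma le_valR_mult:
  assumes "\<gamma> \<le> valR v d" shows "\<gamma> \<le> valR v (c * d)"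
proof -
  have "0 + valR v d \<le> valR v c + valR v d"
    by (intro add_right_mono valR_nonneg)
  then show ?thesis using assms by (simp add: valR_mult)
qed

text \<open>
  Multiplication by an element of \<open>I\<^sub>0\<close> raises every finite valuation, and \<open>v(0) = \<infinity>\<close> exceeds every
  finite bound.
\<close>

lemma less_valR_mult:
  assumes "\<gamma> \<le> valR v d" "\<gamma> < \<infinity>" "0 < valR v c"
  shows "\<gamma> < valR v (c * d)"
proof (cases "c * d = 0")
  case True
  then show ?thesis using assms by (simp add: valR_def val_def)
next
  case False
  then obtain g h where gh: "valR v c = Fin g" "valR v d = Fin h"
    by (auto simp: valR_def val_def)
  then have "valR v d < valR v (c * d)"
    using assms(3) by (simp add: valR_mult zero_extended_def)
  then show ?thesis using assms(1) by simp
qed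

lemma le_valR_add: "\<lbrakk>\<gamma> \<le> valR v c; \<gamma> \<le> valR v d\<rbrakk> \<Longrightarrow> \<gamma> \<le> valR v (c + d)"
  using v_add[of "to_fract c" "to_fract d"] by (auto simp: valR_def min_def split: if_splits)

lemma less_valR_add: "\<lbrakk>\<gamma> < valR v c; \<gamma> < valR v d\<rbrakk> \<Longrightarrow> \<gamma> < valR v (c + d)"
  using v_add[of "to_fract c" "to_fract d"] by (auto simp: valR_def min_def split: if_splits)

lemma le_valR_sum:
  "(\<And>i. i \<in> A \<Longrightarrow> \<gamma> \<le> valR v (h i)) \<Longrightarrow> \<gamma> \<le> valR v (sum h A)"
  by (induction A rule: infinite_finite_induct) (auto intro: le_valR_add, simp_all add: valR_def val_def)

lemma less_valR_diff:
  assumes "\<gamma> < valR v c" "\<gamma> < valR v d" shows "\<gamma> < valR v (c - d)"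
proof -
  have "valR v d \<le> valR v (- d)"
    using le_valR_mult[of "valR v d" d "-1"] by simp
  then show ?thesis using less_valR_add[of \<gamma> c "- d"] assms by simp
qed

lemma max_ideal_iff: "c \<in> max_ideal v \<longleftrightarrow> 0 < valR v c"
  by (simp add: max_ideal_def val_ideal_def valR_def zero_extended_def)

lemma one_plus_max_ideal_unit:
  assumes "0 < valR v c"
  obtains e where "e * (1 + c) = 1"
proof -
  have "\<not> 0 < valR v (1 + c)"
    using less_valR_diff[of 0 "1 + c" c] assms by (auto simp: valR_def val_one)
  then have 0: "valR v (1 + c) = 0" using valR_nonneg[of "1 + c"] by simp
  let ?i = "inverse (to_fract (1 + c))"
  have nz: "to_fract (1 + c) \<noteq> 0"
    using 0 unfolding valR_def val_def zero_extended_def by (auto split: if_splits)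
  have "val v (?i * to_fract (1 + c)) = 0"
    using nz by (simp add: val_one del: to_fract_add)
  then have "val v ?i = 0"
    using 0 unfolding val_mult valR_def
    by (cases "val v ?i") (simp_all add: zero_extended_def del: to_fract_add)
  then have "?i \<in> range to_fract" unfolding range_to_fract by simp
  then obtain e where "?i = to_fract e" by (rule rangeE)
  then have "to_fract (e * (1 + c)) = to_fract 1"
    using nz by (simp del: to_fract_add flip: \<open>?i = to_fract e\<close>)
  then show ?thesis using that by (simp only: to_fract_eq_iff)
qed

text \<open>
  In an arbitrary ordered group the minimum that defines the valuation of a lattice needs an argument. By
  bilinearity every value of the form has at least the smallest valuation occurring on a finite spanning set;
  the zero vector is added to that set so that it is nonempty in rank zero.
\<close>

lemma lattice_val_attained:
  fixes L :: "('r, 'l) bilinear_module"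
  assumes "lattice_over class_ring L"
  obtains p q where "p \<in> carrier L" "q \<in> carrier L" "lattice_val v L = valR v (form L p q)"
    "\<And>u w. \<lbrakk>u \<in> carrier L; w \<in> carrier L\<rbrakk> \<Longrightarrow> lattice_val v L \<le> valR v (form L u w)"
proof -
  interpret lattice_over class_ring L by fact
  obtain bs where bs: "is_basis class_ring L bs" using free_of_finite_rank by auto
  have M: "symmetric_bilinear_module class_ring L" by unfold_locales
  define A where "A = insert \<zero>\<^bsub>L\<^esub> (set bs)"
  have A: "finite A" "A \<subseteq> carrier L" "A \<noteq> {}" "set bs \<subseteq> A"
    using bs by (auto simp: A_def is_basis_def)
  define V where "V = (\<lambda>(u, w). valR v (form L u w)) ` (A \<times> A)"
  have V: "finite V" "V \<noteq> {}" using A by (auto simp: V_def)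
  have min: "Min V \<le> valR v (form L u w)" if u: "u \<in> carrier L" and w: "w \<in> carrier L" for u w
  proof -
    obtain \<xi> where \<xi>: "\<And>z. z \<in> carrier L \<Longrightarrow> form L u z = (\<Sum>b\<in>set bs. \<xi> b * form L b z)"
      using coordinates[OF M bs u] by blast
    obtain \<eta> where \<eta>: "\<And>z. z \<in> carrier L \<Longrightarrow> form L w z = (\<Sum>b\<in>set bs. \<eta> b * form L b z)"
      using coordinates[OF M bs w] by blast
    have "Min V \<le> valR v (form L b w)" if b: "b \<in> set bs" for b
    proof -
      have bL: "b \<in> carrier L" using b A by auto
      have "Min V \<le> valR v (form L b' b)" if "b' \<in> set bs" for b'
        using V b that A by (intro Min_le) (auto simp: V_def)
      then have "Min V \<le> valR v (form L w b)"
        unfolding \<eta>[OF bL] by (intro le_valR_sum le_valR_mult)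
      then show ?thesis using form_sym[OF w bL] by simp
    qed
    then show ?thesis using \<xi>[OF w] by (auto intro!: le_valR_sum le_valR_mult)
  qed
  from V have "Min V \<in> V" by simp
  then obtain p q where pq: "p \<in> A" "q \<in> A" "Min V = valR v (form L p q)"
    unfolding V_def by auto
  have "lattice_val v L = valR v (form L p q)"
    unfolding lattice_val_def using pq A min by (intro Least_equality) auto
  with that[of p q] pq min A show ?thesis by auto
qed

text \<open>
  The two reductions are the same bilinear module: the twist alters values of the form by multiples of
  \<open>c\<close>, which do not change cosets of \<open>I\<^sub>0\<close>.
\<close>

lemma reduction_rank_one_twist:
  fixes M :: "('r, 'm) bilinear_module"
  assumes M: "symmetric_bilinear_module class_ring M" and x: "x \<in> carrier M" and c: "c \<in> max_ideal v"
  shows "isometric (class_ring Quot max_ideal v)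
    (reduction class_ring (max_ideal v) M) (reduction class_ring (max_ideal v) (rank_one_twist c x M))"
proof -
  interpret symmetric_bilinear_module class_ring M by fact
  let ?I = "max_ideal v"
  let ?IM = "ideal_times_module class_ring ?I M"
  have IM: "ideal_times_module class_ring ?I (rank_one_twist c x M) = ?IM"
    using span_rank_one_twist[of M c x] module_axioms by (simp add: ideal_times_module_def)
  have sub: "X \<subseteq> carrier M" if "X \<in> a_rcosets\<^bsub>M\<^esub> ?IM" for X
  proof -
    have "?IM \<subseteq> carrier M"
      unfolding ideal_times_module_def by (intro span_is_subset2) auto
    then show ?thesis using that a_r_coset_subset_G by (auto simp: A_RCOSETS_def RCOSETS_def a_r_coset_def[symmetric])
  qed
  have coset: "?I +>\<^bsub>class_ring\<^esub> (d + c * f) = ?I +>\<^bsub>class_ring\<^esub> d" for d f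
  proof -
    have cf: "0 < valR v (c * f)"
      using c less_valR_mult[of 0 f c] valR_nonneg[of f] by (simp add: max_ideal_iff zero_extended_def)
    have "h + (d + c * f) = (h + c * f) + d" "h + d = (h - c * f) + (d + c * f)" for h
      by simp_all
    moreover have "h + c * f \<in> ?I" "h - c * f \<in> ?I" if "h \<in> ?I" for h
      using that cf less_valR_add less_valR_diff by (auto simp: max_ideal_iff)
    ultimately show ?thesis
      unfolding a_r_coset_def r_coset_def by (simp, safe; blast)
  qed
  let ?Q = "reduction class_ring ?I M" and ?Q' = "reduction class_ring ?I (rank_one_twist c x M)"
  have "(\<lambda>X. X) \<in> LinearCombinations.module_hom (class_ring Quot ?I) ?Q ?Q'"
    unfolding LinearCombinations.module_hom_def reduction_def Let_def IM
    by (simp add: A_RCOSETS_def RCOSETS_def a_r_coset_def r_coset_def set_add_def set_mult_def)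
  moreover have "form ?Q' X Y = form ?Q X Y" if "X \<in> carrier ?Q" "Y \<in> carrier ?Q" for X Y
    unfolding reduction_def Let_def IM using coset by (simp add: mult.assoc)
  moreover have "carrier ?Q' = carrier ?Q"
    unfolding reduction_def Let_def IM
    by (simp add: A_RCOSETS_def RCOSETS_def a_r_coset_def r_coset_def)
  ultimately show ?thesis
    unfolding isometric_def by (intro bexI[of _ "\<lambda>X. X"]) (auto simp: bij_betw_def)
qed

text \<open>
  If \<open>u\<close> and \<open>w\<close> define the same functional for the twisted form, evaluation at \<open>y\<close> gives
  \<open>((u, y) - (w, y)) (1 + c (y, y)) = 0\<close>. Hence the correction terms agree, and \<open>u = w\<close> by nondegeneracy of the
  original form.
\<close>

lemma lattice_rank_one_twist:
  fixes L :: "('r, 'l) bilinear_module"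
  assumes L: "lattice_over class_ring L" and y: "y \<in> carrier L" and nz: "1 + c * form L y y \<noteq> 0"
  shows "lattice_over class_ring (rank_one_twist c y L)"
proof -
  interpret lattice_over class_ring L by fact
  interpret T: Module.module class_ring "rank_one_twist c y L" by (rule module_rank_one_twist) unfold_locales
  show ?thesis
  proof
    show "\<exists>bs. is_basis class_ring (rank_one_twist c y L) bs"
      using free_of_finite_rank is_basis_rank_one_twist[of L] module_axioms by blast
    show "inj_on (form_map (rank_one_twist c y L)) (carrier (rank_one_twist c y L))"
    proof (rule inj_onI, simp)
      fix u w assume u: "u \<in> carrier L" and w: "w \<in> carrier L"
        and "form_map (rank_one_twist c y L) u = form_map (rank_one_twist c y L) w"
      then have eq: "form L u z + c * form L u y * form L z y = form L w z + c * form L w y * form L z y"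
        if "z \<in> carrier L" for z
        using that by (auto simp: form_map_def dest: fun_cong[of _ _ z])
      from eq[OF y] have "(form L u y - form L w y) * (1 + c * form L y y) = 0"
        by (simp add: algebra_simps)
      then have "form L u y = form L w y" using nz by simp
      then have "form_map L u = form_map L w"
        using eq by (auto simp: form_map_def)
      then show "u = w" using nondegenerate u w by (auto dest: inj_onD)
    qed
  next
    fix u w z assume *: "u \<in> carrier (rank_one_twist c y L)" "w \<in> carrier (rank_one_twist c y L)" 
    then show "form (rank_one_twist c y L) u w = form (rank_one_twist c y L) w u"
      using form_sym[of u w] by (simp add: mult_ac)
    show "form (rank_one_twist c y L) (k \<odot>\<^bsub>rank_one_twist c y L\<^esub> u) w = k \<otimes>\<^bsub>class_ring\<^esub> form (rank_one_twist c y L) u w" for k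
      using * y by (simp add: form_smult algebra_simps)
    assume "z \<in> carrier (rank_one_twist c y L)"
    then show "form (rank_one_twist c y L) (u \<oplus>\<^bsub>rank_one_twist c y L\<^esub> w) z = form (rank_one_twist c y L) u z \<oplus>\<^bsub>class_ring\<^esub> form (rank_one_twist c y L) w z"
      using * y by (simp add: form_add algebra_simps)
  qed auto
qed

text \<open>
  The correction \<open>c (u, y) (w, y)\<close> contains two factors of positive valuation at least \<open>v(L)\<close>. So it
  cannot affect the valuation of a value of the form at which a finite \<open>v(L)\<close> is attained; and if \<open>v(L) = \<infinity>\<close>,
  no value can drop below it.
\<close>

lemma lattice_val_rank_one_twist:
  assumes L: "lattice_over class_ring L" and y: "y \<in> carrier L" and pos: "0 < lattice_val v L"
  shows "lattice_val v (rank_one_twist c y L) = lattice_val v L"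
proof -
  let ?\<gamma> = "lattice_val v L"
  obtain p q where p: "p \<in> carrier L" and q: "q \<in> carrier L" and pq: "?\<gamma> = valR v (form L p q)"
    and le: "\<And>u w. \<lbrakk>u \<in> carrier L; w \<in> carrier L\<rbrakk> \<Longrightarrow> ?\<gamma> \<le> valR v (form L u w)"
    using lattice_val_attained[OF L] by blast
  have "?\<gamma> \<le> valR v (form (rank_one_twist c y L) u w)" if "u \<in> carrier L" "w \<in> carrier L" for u w
    using le that y by (auto intro!: le_valR_add le_valR_mult)
  moreover have "valR v (form (rank_one_twist c y L) p q) = ?\<gamma>"
  proof (rule ccontr)
    assume "valR v (form (rank_one_twist c y L) p q) \<noteq> ?\<gamma>"
    with calculation[OF p q] have gt: "?\<gamma> < valR v (form (rank_one_twist c y L) p q)" by simp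
    then have fin: "?\<gamma> < \<infinity>" by (cases "lattice_val v L") auto
    have "0 < valR v (form L p y)"
      using pos le[OF p y] by (rule less_le_trans)
    then have "?\<gamma> < valR v (form L p y * (c * form L q y))"
      using le[OF q y] fin by (intro less_valR_mult le_valR_mult)
    then have "?\<gamma> < valR v (form L p q)"
      using less_valR_diff[OF gt, of "form L p y * (c * form L q y)"] by (simp add: mult_ac)
    then show False using pq by simp
  qed
  ultimately show ?thesis
    unfolding lattice_val_def[of v "rank_one_twist c y L"] using p q by (intro Least_equality) force+
qed

end


section \<open>Splitting off a discriminant closer to one\<close>

theorem proposition5p4:
  fixes v :: "'r::idom fract \<Rightarrow> 'g::linordered_ab_group_add"
    and M :: "('r, 'm) bilinear_module"
    and L :: "('r, 'l) bilinear_module"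
    and bM :: "'m list"
    and r t a b :: 'r
    and x :: 'm and y :: 'l
  assumes "two_henselian_valuation_ring v"
    and "valR v 2 > 0"
    and "lattice_over class_ring M" and "unimodular class_ring M"
    and "is_basis class_ring M bM"
    and "discriminant M bM \<in> 1 +o max_ideal v"
    and "lattice_over class_ring L" and "lattice_val v L > 0"
    and "discriminant M bM = 1 + r" and "r \<noteq> 0"
    and "primitive class_ring M x" and "form M x x = a"
    and "primitive class_ring L y" and "form L y y = b"
    and "to_fract (t\<^sup>2 * a * b) \<in> to_fract r +o val_ideal v (v (to_fract r))"
  shows "\<exists>(N :: ('r, 'm) bilinear_module) (K :: ('r, 'l) bilinear_module).
    lattice_over class_ring N \<and> lattice_over class_ring K \<and>
    isometric class_ring (orthogonal_sum M L) (orthogonal_sum N K) \<and>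
    isometric (class_ring Quot max_ideal v)
      (reduction class_ring (max_ideal v) M) (reduction class_ring (max_ideal v) N) \<and>
    (\<exists>bN s. is_basis class_ring N bN \<and> discriminant N bN = 1 + s \<and> valR v s > valR v r) \<and>
    lattice_val v K = lattice_val v L \<and>
    (\<forall>bL. is_basis class_ring L bL \<longrightarrow>
      (\<exists>bK. is_basis class_ring K bK \<and>
        discriminant K bK = discriminant L bL * (1 + t\<^sup>2 * a * b)))"
proof -
  interpret two_henselian_valuation_ring v by fact
  interpret M: lattice_over class_ring M by fact
  interpret L: lattice_over class_ring L by fact
  have M: "symmetric_bilinear_module class_ring M" and L: "symmetric_bilinear_module class_ring L"
    by unfold_locales
  have x: "x \<in> carrier M" and y: "y \<in> carrier L"
    using \<open>primitive class_ring M x\<close> \<open>primitive class_ring L y\<close> by (simp_all add: primitive_def)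
  note a = \<open>form M x x = a\<close> and b = \<open>form L y y = b\<close>
  let ?c = "t\<^sup>2 * a * b"
  let ?N = "rank_one_twist (t\<^sup>2 * b) x M" and ?K = "rank_one_twist (t\<^sup>2 * a) y L"
  have r: "0 < valR v r"
    using \<open>discriminant M bM \<in> 1 +o max_ideal v\<close> \<open>discriminant M bM = 1 + r\<close>
    by (auto simp: elt_set_plus_def max_ideal_iff)
  have "lattice_val v L \<le> valR v b"
    using lattice_val_attained[OF \<open>lattice_over class_ring L\<close>] y b by metis
  with \<open>lattice_val v L > 0\<close> have b0: "0 < valR v b" by simp
  have fin0: "(0 :: 'g extended) < \<infinity>" by (simp add: zero_extended_def)
  have mult_pos: "0 < valR v (d * f)" if "0 < valR v d" for d f
    using less_valR_mult[OF valR_nonneg fin0 that, of f] .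
  have c0: "0 < valR v ?c" using mult_pos[OF b0, of "t\<^sup>2 * a"] by (simp add: mult_ac)
  obtain e where e: "e * (1 + ?c) = 1" using one_plus_max_ideal_unit[OF c0] by blast
  then have nz: "1 + ?c \<noteq> 0" by auto
  have rfin: "valR v r < \<infinity>" using \<open>r \<noteq> 0\<close> by (simp add: valR_def val_def)
  obtain d' where "to_fract ?c = to_fract r + d'" and d': "Fin (v (to_fract r)) < val v d'"
    using \<open>to_fract ?c \<in> _\<close> by (auto simp: elt_set_plus_def val_ideal_def)
  then have "d' = to_fract (?c - r)" by (simp add: algebra_simps)
  then have d: "valR v r < valR v (?c - r)"
    using d' \<open>r \<noteq> 0\<close> by (simp add: valR_def val_def del: to_fract_diff)
  let ?s = "2 * r + (?c - r) + ?c * r"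
  have s: "valR v r < valR v ?s"
    using d less_valR_mult[OF order_refl rfin] c0 \<open>valR v 2 > 0\<close> by (intro less_valR_add)
  have disc: "discriminant ?N bM = 1 + ?s"
    using discriminant_rank_one_twist[OF M \<open>is_basis class_ring M bM\<close> x, of "t\<^sup>2 * b"] a
      \<open>discriminant M bM = 1 + r\<close>
    by (simp add: algebra_simps)
  have basis: "is_basis class_ring ?N bM"
    using is_basis_rank_one_twist[OF M.module_axioms] \<open>is_basis class_ring M bM\<close> by simp
  show ?thesis
  proof (intro exI[of _ ?N] exI[of _ ?K] conjI)
    show "lattice_over class_ring ?N"
      using nz a by (intro lattice_rank_one_twist x \<open>lattice_over class_ring M\<close>) (simp add: mult_ac)
    show "lattice_over class_ring ?K"
      using nz b by (intro lattice_rank_one_twist y \<open>lattice_over class_ring L\<close>) (simp add: mult_ac)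
    show "isometric class_ring (orthogonal_sum M L) (orthogonal_sum ?N ?K)"
      using isometric_orthogonal_sum_rank_one_twist[OF M L x y, of e t] e by (simp add: a b)
    show "isometric (class_ring Quot max_ideal v)
        (reduction class_ring (max_ideal v) M) (reduction class_ring (max_ideal v) ?N)"
      using mult_pos[OF b0, of "t\<^sup>2"]
      by (intro reduction_rank_one_twist M x) (simp add: max_ideal_iff mult_ac)
    show "\<exists>bN s. is_basis class_ring ?N bN \<and> discriminant ?N bN = 1 + s \<and> valR v s > valR v r"
      by (intro exI[of _ bM] exI[of _ ?s] conjI basis disc s)
    show "lattice_val v ?K = lattice_val v L"
      by (intro lattice_val_rank_one_twist y \<open>lattice_over class_ring L\<close> \<open>lattice_val v L > 0\<close>)
    show "\<forall>bL. is_basis class_ring L bL \<longrightarrow> (\<exists>bK. is_basis class_ring ?K bK \<and>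
        discriminant ?K bK = discriminant L bL * (1 + ?c))"
    proof (intro allI impI exI conjI)
      fix bL assume bL: "is_basis class_ring L bL"
      then show "is_basis class_ring ?K bL"
        using is_basis_rank_one_twist[OF L.module_axioms] by simp
      have "1 + t\<^sup>2 * a * form L y y = 1 + ?c" by (simp add: b)
      then show "discriminant ?K bL = discriminant L bL * (1 + ?c)"
        using discriminant_rank_one_twist[OF L bL y, of "t\<^sup>2 * a"] by simp
    qed
  qed
qed

end
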